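(* The polynomials $d_n^B(q)$ form a Sturm sequence: for each $n\geq 1$, $d_n^B(q)$ has $n$ distinct real roots, all non-positive, and these roots are separated (interlaced) by the roots of $d_{n-1}^B(q)$.
   Context: Let $B_n$ be the set of signed permutations $\sigma=\sigma_1\cdots\sigma_n$ of $[n]=\{1,\dots,n\}$ (permutations of $[n]$ in which some entries carry a minus sign). An index $i\in[n]$ is a type $B$ excedance of $\sigma$ if either $\sigma_i=-i$ or $\sigma_{|\sigma_i|}>\sigma_i$; $\mathrm{exc}_B(\sigma)$ denotes the number of type $B$ excedances. A type $B$ derangement is $\sigma\in B_n$ with $\sigma_i\neq i$ for all $i\in[n]$ (entries $\sigma_i=-i$ are allowed); $D_n^B$ is the set of these. Define $d_n^B(q)=\sum_{\sigma\in D_n^B}q^{\mathrm{exc}_B(\sigma)}$ for $n\geq1$ and $d_0^B(q)=1$. *)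

theory Defs
  imports Complex_Main "HOL-Library.FuncSet" "HOL-Computational_Algebra.Polynomial"
begin

text \<open>
  The word \<open>\<sigma>\<^sub>1 \<dots> \<sigma>\<^sub>n\<close> of a signed permutation is a function from positions \<open>1, \<dots>, n\<close> to the
  integers, \<^const>\<open>undefined\<close> off \<open>{1..n}\<close> so that each word is represented exactly once; removing
  the signs leaves a permutation of \<open>{1..n}\<close>.
\<close>

definition signed_perms :: "nat \<Rightarrow> (nat \<Rightarrow> int) set" where
  "signed_perms n =
     {\<sigma> \<in> {1..n} \<rightarrow>\<^sub>E UNIV. bij_betw (\<lambda>i. nat \<bar>\<sigma> i\<bar>) {1..n} {1..n}}"

lemma finite_signed_perms: "finite (signed_perms n)"
proof (rule finite_subset)
  show "signed_perms n \<subseteq> {1..n} \<rightarrow>\<^sub>E {- int n..int n}"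
  proof
    fix \<sigma> assume s: "\<sigma> \<in> signed_perms n"
    have "\<sigma> i \<in> {- int n..int n}" if "i \<in> {1..n}" for i
    proof -
      have "nat \<bar>\<sigma> i\<bar> \<in> {1..n}"
        using s that unfolding signed_perms_def bij_betw_def by blast
      then show ?thesis by auto
    qed
    then show "\<sigma> \<in> {1..n} \<rightarrow>\<^sub>E {- int n..int n}"
      using s unfolding signed_perms_def by (auto simp: PiE_def)
  qed
  show "finite ({1..n} \<rightarrow>\<^sub>E {- int n..int n})"
    by (intro finite_PiE) auto
qed

definition exc_B :: "nat \<Rightarrow> (nat \<Rightarrow> int) \<Rightarrow> nat" where
  "exc_B n \<sigma> = card {i \<in> {1..n}. \<sigma> i = - int i \<or> \<sigma> (nat \<bar>\<sigma> i\<bar>) > \<sigma> i}"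

definition derangements_B :: "nat \<Rightarrow> (nat \<Rightarrow> int) set" where
  "derangements_B n = {\<sigma> \<in> signed_perms n. \<forall>i \<in> {1..n}. \<sigma> i \<noteq> int i}"

definition derangement_poly_B :: "nat \<Rightarrow> real poly" where
  "derangement_poly_B n =
     (if n = 0 then 1 else (\<Sum>\<sigma> \<in> derangements_B n. monom 1 (exc_B n \<sigma>)))"

text \<open>
  \<open>g\<close> interlaces \<open>f\<close>: both have only real roots, \<open>deg f = deg g + 1\<close>, and, listing the roots with
  multiplicity in increasing order, \<open>r\<^sub>0 \<le> s\<^sub>0 \<le> r\<^sub>1 \<le> s\<^sub>1 \<le> \<dots> \<le> s\<^sub>m \<le> r\<^sub>m\<^sub>+\<^sub>1\<close>. The inequalities are
  weak, since consecutive derangement polynomials of positive index share the root \<open>0\<close>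
  (for instance \<open>q\<close> and \<open>q\<^sup>2 + 4q\<close>).
\<close>

definition interlaces :: "real poly \<Rightarrow> real poly \<Rightarrow> bool" where
  "interlaces g f \<longleftrightarrow>
     (\<exists>rs ss a b. a \<noteq> 0 \<and> b \<noteq> 0 \<and> sorted rs \<and> sorted ss \<and>
        f = smult a (\<Prod>r\<leftarrow>rs. [:- r, 1:]) \<and> g = smult b (\<Prod>s\<leftarrow>ss. [:- s, 1:]) \<and>
        length rs = Suc (length ss) \<and>
        (\<forall>i < length ss. rs ! i \<le> ss ! i \<and> ss ! i \<le> rs ! Suc i))"

end

theory Submission imports Defs begin

text \<open>
  Let \<open>m\<close> be the largest letter of a derangement. Either \<open>\<sigma>\<^sub>m = -m\<close>, or removing \<open>\<plusminus>m\<close> from its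
  cycle leaves a derangement of the other letters, or it leaves a signed permutation with exactly
  one fixed point. Tracking excedances in the three cases gives
  \<open>d\<^sub>n\<^sub>+\<^sub>1 = (2n+1) q d\<^sub>n + 2q(1-q) d\<^sub>n' + 2n q d\<^sub>n\<^sub>-\<^sub>1\<close>. Working with signed permutations of an arbitrary
  finite set of letters makes relabelling unnecessary.

  Write \<open>d\<^sub>n\<^sub>+\<^sub>1 = q e\<^sub>n\<close> with \<open>e\<^sub>n\<close> monic of degree \<open>n\<close>. At a root of \<open>e\<^sub>n\<close>, necessarily negative, the
  recurrence makes \<open>e\<^sub>n\<^sub>+\<^sub>1\<close> a negative combination of \<open>e\<^sub>n'\<close> and \<open>e\<^sub>n\<^sub>-\<^sub>1\<close>, which have the same sign there
  if the roots of \<open>e\<^sub>n\<^sub>-\<^sub>1\<close> interlace those of \<open>e\<^sub>n\<close>. So the signs of \<open>e\<^sub>n\<^sub>+\<^sub>1\<close> alternate along \<open>-\<infinity>\<close>, the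
  roots of \<open>e\<^sub>n\<close>, and \<open>0\<close>, which locates its \<open>n+1\<close> roots strictly between these points.
\<close>

subsection \<open>The recurrence\<close>

definition signed_perms_on :: "nat set \<Rightarrow> (nat \<Rightarrow> int) set" where
  "signed_perms_on A = {\<sigma> \<in> A \<rightarrow>\<^sub>E UNIV. bij_betw (\<lambda>i. nat \<bar>\<sigma> i\<bar>) A A}"

definition derangements_on :: "nat set \<Rightarrow> (nat \<Rightarrow> int) set" where
  "derangements_on A = {\<sigma> \<in> signed_perms_on A. \<forall>i\<in>A. \<sigma> i \<noteq> int i}"

text \<open>
  Type \<open>B\<close> excedances indexed by \<open>k = \<bar>\<sigma>\<^sub>i\<bar>\<close> instead of \<open>i\<close>: the weak inequality for negative
  entries absorbs the exceptional case \<open>\<sigma>\<^sub>i = -i\<close>, and membership of \<open>k\<close> depends only on \<open>\<sigma>\<^sub>k\<close> and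
  on the sign of the entry \<open>\<plusminus>k\<close>, so inserting a new maximum disturbs a single index.
\<close>

definition excedances :: "nat set \<Rightarrow> (nat \<Rightarrow> int) \<Rightarrow> nat set" where
  "excedances A \<sigma> =
     {k \<in> A. if - int k \<in> \<sigma> ` A then - int k \<le> \<sigma> k else int k < \<sigma> k}"

definition exc_poly :: "nat set \<Rightarrow> real poly" where
  "exc_poly A = (\<Sum>\<sigma>\<in>derangements_on A. monom 1 (card (excedances A \<sigma>)))"

lemma signed_perms_onD:
  assumes "\<sigma> \<in> signed_perms_on A"
  shows "\<And>i. i \<in> A \<Longrightarrow> nat \<bar>\<sigma> i\<bar> \<in> A" "\<And>i. i \<notin> A \<Longrightarrow> \<sigma> i = undefined"
    "\<And>i j. i \<in> A \<Longrightarrow> j \<in> A \<Longrightarrow> \<bar>\<sigma> i\<bar> = \<bar>\<sigma> j\<bar> \<Longrightarrow> i = j"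
    "\<And>k. k \<in> A \<Longrightarrow> \<exists>i\<in>A. \<bar>\<sigma> i\<bar> = int k"
proof -
  have b: "bij_betw (\<lambda>i. nat \<bar>\<sigma> i\<bar>) A A" and e: "\<sigma> \<in> A \<rightarrow>\<^sub>E UNIV"
    using assms by (auto simp: signed_perms_on_def)
  show "\<And>i. i \<in> A \<Longrightarrow> nat \<bar>\<sigma> i\<bar> \<in> A" using b by (auto simp: bij_betw_def)
  show "\<And>i. i \<notin> A \<Longrightarrow> \<sigma> i = undefined" using e by (auto simp: PiE_def extensional_def)
  show "\<And>i j. i \<in> A \<Longrightarrow> j \<in> A \<Longrightarrow> \<bar>\<sigma> i\<bar> = \<bar>\<sigma> j\<bar> \<Longrightarrow> i = j"
    using b by (auto simp: bij_betw_def inj_on_def)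
  show "\<exists>i\<in>A. \<bar>\<sigma> i\<bar> = int k" if "k \<in> A" for k
  proof -
    have "k \<in> (\<lambda>i. nat \<bar>\<sigma> i\<bar>) ` A" using b that by (auto simp: bij_betw_def)
    then show ?thesis by force
  qed
qed

text \<open>Surjectivity of the absolute values comes from injectivity, \<open>A\<close> being
  finite.\<close>

lemma signed_perms_onI:
  assumes "finite A" "\<And>i. i \<in> A \<Longrightarrow> nat \<bar>\<sigma> i\<bar> \<in> A" "\<And>i. i \<notin> A \<Longrightarrow> \<sigma> i = undefined"
    "\<And>i j. i \<in> A \<Longrightarrow> j \<in> A \<Longrightarrow> \<bar>\<sigma> i\<bar> = \<bar>\<sigma> j\<bar> \<Longrightarrow> i = j"
  shows "\<sigma> \<in> signed_perms_on A"
proof -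
  have "inj_on (\<lambda>i. nat \<bar>\<sigma> i\<bar>) A" using assms(4) by (auto simp: inj_on_def)
  moreover from this have "(\<lambda>i. nat \<bar>\<sigma> i\<bar>) ` A = A"
    using assms(1,2) by (intro endo_inj_surj) auto
  ultimately have "bij_betw (\<lambda>i. nat \<bar>\<sigma> i\<bar>) A A" by (simp add: bij_betw_def)
  then show ?thesis
    using assms(3) by (simp add: signed_perms_on_def PiE_def extensional_def)
qed

lemma signed_perms_on_atLeastAtMost: "signed_perms_on {1..n} = signed_perms n"
  by (simp add: signed_perms_on_def signed_perms_def)

lemma finite_signed_perms_on:
  assumes "finite A"
  shows "finite (signed_perms_on A)"
proof (rule finite_subset)
  show "signed_perms_on A \<subseteq> A \<rightarrow>\<^sub>E (int ` A \<union> uminus ` int ` A)"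
  proof
    fix \<sigma> assume s: "\<sigma> \<in> signed_perms_on A"
    have "\<sigma> i \<in> int ` A \<union> uminus ` int ` A" if "i \<in> A" for i
    proof (cases "\<sigma> i \<ge> 0")
      case True
      then have "\<sigma> i = int (nat \<bar>\<sigma> i\<bar>)" by simp
      then show ?thesis using signed_perms_onD(1)[OF s that] by blast
    next
      case False
      then have "\<sigma> i = - int (nat \<bar>\<sigma> i\<bar>)" by simp
      then show ?thesis using signed_perms_onD(1)[OF s that] by blast
    qed
    then show "\<sigma> \<in> A \<rightarrow>\<^sub>E (int ` A \<union> uminus ` int ` A)"
      using signed_perms_onD(2)[OF s] by (auto simp: PiE_def extensional_def)
  qed
  show "finite (A \<rightarrow>\<^sub>E (int ` A \<union> uminus ` int ` A))"
    using assms by (intro finite_PiE) auto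
qed

lemma finite_derangements_on: "finite A \<Longrightarrow> finite (derangements_on A)"
  using finite_signed_perms_on by (simp add: derangements_on_def)

text \<open>The bijection sending \<open>i\<close> to \<open>k = \<bar>\<sigma> i\<bar>\<close>
  carries one index set onto the other. If the entry is \<open>-k\<close>, then
  \<open>\<sigma> i = - i\<close> and \<open>\<sigma> k = - k\<close> both amount to
  \<open>i = k\<close>, so the exceptional case becomes the equality case of
  \<open>- k \<le> \<sigma> k\<close>.\<close>

lemma exc_B_eq_card_excedances:
  assumes s: "\<sigma> \<in> signed_perms n"
  shows "exc_B n \<sigma> = card (excedances {1..n} \<sigma>)"
proof -
  let ?A = "{1..n}" and ?a = "\<lambda>i. nat \<bar>\<sigma> i\<bar>"
  let ?L = "{i \<in> ?A. \<sigma> i = - int i \<or> \<sigma> (?a i) > \<sigma> i}"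
  note D = signed_perms_onD[OF s[folded signed_perms_on_atLeastAtMost]]
  have b: "bij_betw ?a ?A ?A" using s by (simp add: signed_perms_def)
  have key: "i \<in> ?L \<longleftrightarrow> ?a i \<in> excedances ?A \<sigma>" if i: "i \<in> ?A" for i
  proof -
    obtain k where k: "?a i = k" by simp
    have kA: "k \<in> ?A" using D(1)[OF i] k by simp
    have exc: "k \<in> excedances ?A \<sigma> \<longleftrightarrow>
        (if - int k \<in> \<sigma> ` ?A then - int k \<le> \<sigma> k else int k < \<sigma> k)"
      using kA by (simp add: excedances_def)
    have "(\<sigma> i = - int i \<or> \<sigma> k > \<sigma> i) \<longleftrightarrow> k \<in> excedances ?A \<sigma>"
    proof (cases "\<sigma> i < 0")
      case True
      then have si: "\<sigma> i = - int k" using k by linarith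
      then have "- int k \<in> \<sigma> ` ?A" using i by (metis imageI)
      moreover have "\<sigma> i = - int i \<longleftrightarrow> \<sigma> k = - int k"
      proof
        assume "\<sigma> i = - int i"
        then have "k = i" using si by simp
        then show "\<sigma> k = - int k" using si by simp
      next
        assume "\<sigma> k = - int k"
        then have "\<bar>\<sigma> k\<bar> = \<bar>\<sigma> i\<bar>" using si by simp
        then have "k = i" by (rule D(3)[OF kA i])
        then show "\<sigma> i = - int i" using si by simp
      qed
      ultimately show ?thesis unfolding exc si by auto
    next
      case False
      then have si: "\<sigma> i = int k" using k by linarith
      \<comment> \<open>A word never contains both \<open>k\<close> and \<open>-k\<close>, so a
        positive entry selects the strict branch.\<close>
      have "- int k \<notin> \<sigma> ` ?A"
      proof
        assume "- int k \<in> \<sigma> ` ?A"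
        then obtain j where j: "j \<in> ?A" "\<sigma> j = - int k" by auto
        have "\<bar>\<sigma> j\<bar> = \<bar>\<sigma> i\<bar>" using j(2) si by simp
        then have "j = i" by (rule D(3)[OF j(1) i])
        then show False using j(2) kA si by simp
      qed
      moreover have "\<sigma> i \<noteq> - int i" using False i by auto
      ultimately show ?thesis unfolding exc si by simp
    qed
    then show ?thesis using i k by simp
  qed
  have "bij_betw ?a {i \<in> ?A. i \<in> ?L} {k \<in> ?A. k \<in> excedances ?A \<sigma>}"
    by (rule bij_betw_Collect[OF b], rule key[symmetric])
  moreover have "{i \<in> ?A. i \<in> ?L} = ?L" "{k \<in> ?A. k \<in> excedances ?A \<sigma>} = excedances ?A \<sigma>"
    by (auto simp: excedances_def)
  ultimately have "bij_betw ?a ?L (excedances ?A \<sigma>)" by (simp only:)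
  then have "card ?L = card (excedances ?A \<sigma>)" by (rule bij_betw_same_card)
  then show ?thesis unfolding exc_B_def .
qed

text \<open>For \<open>n = 0\<close> the everywhere \<open>undefined\<close> word is the single
  derangement and has no excedances, which matches the default value \<open>1\<close>.\<close>

lemma exc_poly_atLeastAtMost: "exc_poly {1..n} = derangement_poly_B n"
proof (cases "n = 0")
  case True
  have "derangements_on {1..0} = {\<lambda>_. undefined}"
    by (auto simp: derangements_on_def signed_perms_on_def bij_betw_def)
  moreover have "excedances {1..0} (\<lambda>_. undefined) = {}" by (simp add: excedances_def)
  ultimately show ?thesis using True by (simp add: exc_poly_def derangement_poly_B_def)
next
  case False
  have "derangements_on {1..n} = derangements_B n"
    by (simp only: derangements_on_def derangements_B_def signed_perms_on_atLeastAtMost)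
  then show ?thesis using False unfolding exc_poly_def derangement_poly_B_def
    by (auto intro!: sum.cong simp: exc_B_eq_card_excedances derangements_B_def)
qed

section \<open>Inserting a largest letter\<close>

text \<open>The letter \<open>m\<close> enters the cycle right after \<open>i\<close>, with sign
  given by \<open>v\<close>. Letters of \<open>A\<close> other than \<open>i\<close> keep their
  image and the sign with which they occur. If \<open>v = m\<close>, then \<open>i\<close> becomes
  an excedance and \<open>m\<close> is none; if \<open>v = -m\<close>, it is the other way
  round.\<close>

lemma excedances_insert_value:
  assumes s: "\<sigma> \<in> signed_perms_on A" and i: "i \<in> A" and v: "v \<in> {int m, - int m}"
    and A: "\<And>k. k \<in> A \<Longrightarrow> 0 < k \<and> k < m"
  shows "excedances (insert m A) (\<sigma>(m := \<sigma> i, i := v)) =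
    insert (if v = int m then i else m) (excedances A \<sigma> - {i})"
proof -
  let ?t = "\<sigma>(m := \<sigma> i, i := v)"
  have m: "m \<notin> A" using A by blast
  have ne: "i \<noteq> m" using i m by auto
  have im: "?t ` insert m A = insert v (\<sigma> ` A)"
    using i m by auto
  have bd: "\<bar>\<sigma> j\<bar> < int m" if "j \<in> A" for j
    using A[OF signed_perms_onD(1)[OF s that]] by linarith
  have nm: "- int m \<notin> \<sigma> ` A" using bd by force
  have "k \<in> excedances (insert m A) ?t \<longleftrightarrow>
      k \<in> insert (if v = int m then i else m) (excedances A \<sigma> - {i})" for k
  proof -
    consider "k = m" | "k = i" | "k \<in> A" "k \<noteq> i" "k \<noteq> m" | "k \<notin> insert m A" by blast
    then show ?thesis
    proof cases
      case 1
      then show ?thesis using v m ne i nm bd[OF i] A[OF i] unfolding excedances_def im by auto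
    next
      case 2
      then show ?thesis using v m ne i A[OF i] unfolding excedances_def im by auto
    next
      case 3
      then show ?thesis using v A[OF 3(1)] unfolding excedances_def im by auto
    next
      case 4
      then show ?thesis using i by (auto simp: excedances_def)
    qed
  qed
  then show ?thesis by blast
qed

lemma finite_excedances: "finite A \<Longrightarrow> finite (excedances A \<sigma>)"
  by (simp add: excedances_def)

lemma card_excedances_insert_value:
  assumes "finite A" "\<sigma> \<in> signed_perms_on A" "i \<in> A" "v \<in> {int m, - int m}"
    "\<And>k. k \<in> A \<Longrightarrow> 0 < k \<and> k < m"
  shows "card (excedances (insert m A) (\<sigma>(m := \<sigma> i, i := v))) = Suc (card (excedances A \<sigma> - {i}))"
proof -
  have "m \<notin> excedances A \<sigma>" using assms(5) by (auto simp: excedances_def)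
  then show ?thesis
    using finite_excedances[OF assms(1), of \<sigma>]
    by (subst excedances_insert_value[OF assms(2-5)]) auto
qed

text \<open>Bypassing \<open>m\<close> in its cycle undoes the insertion: \<open>i\<close> is the
  unique position carrying \<open>\<plusminus>m\<close>, \<open>v\<close> is its entry, and
  \<open>\<sigma> i\<close> is recovered from position \<open>m\<close>.\<close>

lemma bij_betw_insert_value:
  assumes fin: "finite A" and A: "\<And>k. k \<in> A \<Longrightarrow> 0 < k \<and> k < m"
  shows "bij_betw (\<lambda>(i, v, \<sigma>). \<sigma>(m := \<sigma> i, i := v))
    (A \<times> {int m, - int m} \<times> signed_perms_on A)
    {\<tau> \<in> signed_perms_on (insert m A). \<bar>\<tau> m\<bar> \<noteq> int m}"
proof -
  let ?f = "\<lambda>(i, v, \<sigma>). \<sigma>(m := \<sigma> i, i := v)"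
  let ?X = "A \<times> {int m, - int m} \<times> signed_perms_on A"
  let ?Y = "{\<tau> \<in> signed_perms_on (insert m A). \<bar>\<tau> m\<bar> \<noteq> int m}"
  have m: "m \<notin> A" using A by blast
  have bd: "\<bar>\<sigma> j\<bar> < int m" if "j \<in> A" "\<sigma> \<in> signed_perms_on A" for j \<sigma>
    using A[OF signed_perms_onD(1)[OF that(2,1)]] by linarith
  have "inj_on ?f ?X"
  proof (rule inj_onI)
    fix x y assume "x \<in> ?X" "y \<in> ?X" and f_eq: "?f x = ?f y"
    then obtain i v \<sigma> j w \<rho> where x: "x = (i, v, \<sigma>)" and y: "y = (j, w, \<rho>)"
      and i: "i \<in> A" and v: "v \<in> {int m, - int m}" and s: "\<sigma> \<in> signed_perms_on A"
      and j: "j \<in> A" and w: "w \<in> {int m, - int m}" and r: "\<rho> \<in> signed_perms_on A"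
      by blast
    have eq: "\<sigma>(m := \<sigma> i, i := v) = \<rho>(m := \<rho> j, j := w)" using f_eq x y by simp
    have ij: "i = j"
    proof (rule ccontr)
      assume ne: "i \<noteq> j"
      have "v = \<rho> i" using fun_cong[OF eq, of i] ne i m by (auto split: if_splits)
      then show False using bd[OF i r] v by auto
    qed
    have vw: "v = w" using fun_cong[OF eq, of i] ij by simp
    have "\<sigma> k = \<rho> k" for k
    proof -
      consider "k = m" | "k = i" | "k \<noteq> i" "k \<noteq> m" by blast
      then show ?thesis
      proof cases
        case 1
        then show ?thesis using signed_perms_onD(2)[OF s m] signed_perms_onD(2)[OF r m] by simp
      next
        case 2
        then show ?thesis using fun_cong[OF eq, of m] ij i m by (auto split: if_splits)
      next
        case 3
        then show ?thesis using fun_cong[OF eq, of k] ij by simp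
      qed
    qed
    then show "x = y" using ij vw x y by auto
  qed
  moreover have "?f ` ?X \<subseteq> ?Y"
  proof (rule image_subsetI)
    fix x assume "x \<in> ?X"
    then obtain i v \<sigma> where x: "x = (i, v, \<sigma>)"
      and i: "i \<in> A" and v: "v \<in> {int m, - int m}" and s: "\<sigma> \<in> signed_perms_on A" by blast
    let ?t = "\<sigma>(m := \<sigma> i, i := v)"
    have ne: "i \<noteq> m" using i m by auto
    have av: "\<bar>v\<bar> = int m" using v by auto
    have "?t \<in> signed_perms_on (insert m A)"
    proof (rule signed_perms_onI)
      show "finite (insert m A)" using fin by simp
      show "nat \<bar>?t k\<bar> \<in> insert m A" if "k \<in> insert m A" for k
        using that signed_perms_onD(1)[OF s] i av by auto
      show "?t k = undefined" if "k \<notin> insert m A" for k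
        using that i signed_perms_onD(2)[OF s] by auto
      fix k l assume k: "k \<in> insert m A" and l: "l \<in> insert m A" and eq: "\<bar>?t k\<bar> = \<bar>?t l\<bar>"
      have *: "\<bar>?t k\<bar> = int m \<longleftrightarrow> k = i" if "k \<in> insert m A" for k
        using that av ne bd[OF i s] bd[OF _ s, of k] by auto
      \<comment> \<open>Position \<open>m\<close> holds the entry formerly at \<open>i\<close>;
        \<open>g\<close> traces positions other than \<open>i\<close> back to
        \<open>\<sigma>\<close>, reducing injectivity to that of \<open>\<sigma>\<close>.\<close>
      define g where "g k = (if k = m then i else k)" for k
      show "k = l"
      proof (cases "k = i \<or> l = i")
        case True
        then show ?thesis using *[OF k] *[OF l] eq by auto
      next
        case False
        then have "?t k = \<sigma> (g k)" "?t l = \<sigma> (g l)" by (auto simp: g_def)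
        moreover have "g k \<in> A" "g l \<in> A" using k l i by (auto simp: g_def)
        ultimately have "g k = g l" using signed_perms_onD(3)[OF s] eq by metis
        then show ?thesis using False by (auto simp: g_def split: if_splits)
      qed
    qed
    then show "?f x \<in> ?Y"
      using ne bd[OF i s] x by auto
  qed
  moreover have "?Y \<subseteq> ?f ` ?X"
  proof
    fix \<tau> assume "\<tau> \<in> ?Y"
    then have t: "\<tau> \<in> signed_perms_on (insert m A)" and tm: "\<bar>\<tau> m\<bar> \<noteq> int m" by auto
    note D = signed_perms_onD[OF t]
    obtain i where i: "i \<in> insert m A" "\<bar>\<tau> i\<bar> = int m" using D(4)[of m] by auto
    have iA: "i \<in> A" and ne: "i \<noteq> m" using i tm by auto
    define \<sigma> where "\<sigma> = \<tau>(i := \<tau> m, m := undefined)"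
    have abs_ne: "\<bar>\<tau> k\<bar> \<noteq> int m" if "k \<in> insert m A" "k \<noteq> i" for k
      using D(3)[OF that(1) i(1)] i(2) that(2) by auto
    have "\<sigma> \<in> signed_perms_on A"
    proof (rule signed_perms_onI[OF fin])
      show "nat \<bar>\<sigma> k\<bar> \<in> A" if "k \<in> A" for k
      proof -
        have "k \<noteq> m" using that m by auto
        then have "\<exists>l. l \<in> insert m A \<and> l \<noteq> i \<and> \<sigma> k = \<tau> l" using that ne unfolding \<sigma>_def by auto
        then obtain l where l: "l \<in> insert m A" "l \<noteq> i" "\<sigma> k = \<tau> l" by blast
        show ?thesis using D(1)[OF l(1)] abs_ne[OF l(1,2)] l(3) by auto
      qed
      show "\<sigma> k = undefined" if "k \<notin> A" for k
        using that iA D(2) by (auto simp: \<sigma>_def)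
      fix k l assume k: "k \<in> A" and l: "l \<in> A" and eq: "\<bar>\<sigma> k\<bar> = \<bar>\<sigma> l\<bar>"
      define g where "g k = (if k = i then m else k)" for k
      have "\<sigma> k = \<tau> (g k)" "\<sigma> l = \<tau> (g l)" using k l m by (auto simp: g_def \<sigma>_def)
      then have "\<bar>\<tau> (g k)\<bar> = \<bar>\<tau> (g l)\<bar>" using eq by simp
      moreover have "g k \<in> insert m A" "g l \<in> insert m A" using k l by (auto simp: g_def)
      ultimately have "g k = g l" using D(3) by blast
      then show "k = l" using k l m by (auto simp: g_def split: if_splits)
    qed
    moreover have "\<tau> = \<sigma>(m := \<sigma> i, i := \<tau> i)"
      using ne by (auto simp: \<sigma>_def fun_eq_iff)
    moreover have "\<tau> i \<in> {int m, - int m}" using i(2) by auto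
    ultimately show "\<tau> \<in> ?f ` ?X" using iA by (intro image_eqI[of _ _ "(i, \<tau> i, \<sigma>)"]) auto
  qed
  ultimately show ?thesis unfolding bij_betw_def by blast
qed

text \<open>A derangement with \<open>\<bar>\<tau> m\<bar> = m\<close> has
  \<open>\<tau> m = - m\<close>, so this entry carries no information and can be erased and
  restored.\<close>

lemma derangements_on_insert_fixed:
  assumes fin: "finite A" and A: "\<And>k. k \<in> A \<Longrightarrow> 0 < k \<and> k < m" and m: "0 < m"
  shows "bij_betw (\<lambda>\<sigma>. \<sigma>(m := - int m)) (derangements_on A)
    {\<tau> \<in> derangements_on (insert m A). \<bar>\<tau> m\<bar> = int m}"
proof (rule bij_betw_byWitness[where f' = "\<lambda>\<tau>. \<tau>(m := undefined)"])
  have mA: "m \<notin> A" using A by blast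
  show "\<forall>\<sigma>\<in>derangements_on A. (\<sigma>(m := - int m))(m := undefined) = \<sigma>"
    using mA by (auto simp: derangements_on_def fun_eq_iff signed_perms_onD(2))
  show "\<forall>\<tau>\<in>{\<tau> \<in> derangements_on (insert m A). \<bar>\<tau> m\<bar> = int m}.
      (\<tau>(m := undefined))(m := - int m) = \<tau>"
    using m by (auto simp: derangements_on_def fun_eq_iff)
  show "(\<lambda>\<sigma>. \<sigma>(m := - int m)) ` derangements_on A
      \<subseteq> {\<tau> \<in> derangements_on (insert m A). \<bar>\<tau> m\<bar> = int m}"
  proof (rule image_subsetI)
    fix \<sigma> assume d: "\<sigma> \<in> derangements_on A"
    then have s: "\<sigma> \<in> signed_perms_on A" by (simp add: derangements_on_def)
    have bd: "\<bar>\<sigma> j\<bar> < int m" if "j \<in> A" for j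
      using A[OF signed_perms_onD(1)[OF s that]] by linarith
    have "\<sigma>(m := - int m) \<in> signed_perms_on (insert m A)"
    proof (rule signed_perms_onI)
      show "finite (insert m A)" using fin by simp
      show "nat \<bar>(\<sigma>(m := - int m)) k\<bar> \<in> insert m A" if "k \<in> insert m A" for k
        using that signed_perms_onD(1)[OF s] by auto
      show "(\<sigma>(m := - int m)) k = undefined" if "k \<notin> insert m A" for k
        using that signed_perms_onD(2)[OF s] by auto
      show "k = l" if "k \<in> insert m A" "l \<in> insert m A"
        "\<bar>(\<sigma>(m := - int m)) k\<bar> = \<bar>(\<sigma>(m := - int m)) l\<bar>" for k l
        using that bd[of k] bd[of l] signed_perms_onD(3)[OF s, of k l] by (auto split: if_splits)
    qed
    then show "\<sigma>(m := - int m) \<in> {\<tau> \<in> derangements_on (insert m A). \<bar>\<tau> m\<bar> = int m}"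
      using d m by (auto simp: derangements_on_def)
  qed
  show "(\<lambda>\<tau>. \<tau>(m := undefined)) ` {\<tau> \<in> derangements_on (insert m A). \<bar>\<tau> m\<bar> = int m}
      \<subseteq> derangements_on A"
  proof (rule image_subsetI)
    fix \<tau> assume d: "\<tau> \<in> {\<tau> \<in> derangements_on (insert m A). \<bar>\<tau> m\<bar> = int m}"
    then have s: "\<tau> \<in> signed_perms_on (insert m A)" and tm: "\<bar>\<tau> m\<bar> = int m"
      by (auto simp: derangements_on_def)
    note D = signed_perms_onD[OF s]
    have "\<tau>(m := undefined) \<in> signed_perms_on A"
    proof (rule signed_perms_onI[OF fin])
      show "nat \<bar>(\<tau>(m := undefined)) k\<bar> \<in> A" if "k \<in> A" for k
        using that D(1)[of k] D(3)[of k m] tm mA by auto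
      show "(\<tau>(m := undefined)) k = undefined" if "k \<notin> A" for k
        using that D(2) by auto
      show "k = l" if "k \<in> A" "l \<in> A"
        "\<bar>(\<tau>(m := undefined)) k\<bar> = \<bar>(\<tau>(m := undefined)) l\<bar>" for k l
        using that D(3)[of k l] mA by (auto split: if_splits)
    qed
    then show "\<tau>(m := undefined) \<in> derangements_on A"
      using d mA by (auto simp: derangements_on_def)
  qed
qed

text \<open>Placing \<open>\<plusminus>m\<close> at position \<open>i\<close> destroys a fixed point
  there, so words whose only fixed point is \<open>i\<close> also yield derangements after
  insertion. Erasing that fixed point identifies them with derangements of the remaining
  letters.\<close>

lemma derangements_on_remove_fixed:
  assumes fin: "finite A" and i: "i \<in> A"
  shows "bij_betw (\<lambda>\<sigma>. \<sigma>(i := int i)) (derangements_on (A - {i}))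
    {\<tau> \<in> signed_perms_on A. (\<forall>k\<in>A - {i}. \<tau> k \<noteq> int k) \<and> \<tau> i = int i}"
    (is "bij_betw _ _ ?Y")
proof (rule bij_betw_byWitness[where f' = "\<lambda>\<tau>. \<tau>(i := undefined)"])
  show "\<forall>\<sigma>\<in>derangements_on (A - {i}). (\<sigma>(i := int i))(i := undefined) = \<sigma>"
    by (auto simp: derangements_on_def fun_eq_iff signed_perms_onD(2))
  show "\<forall>\<tau>\<in>?Y. (\<tau>(i := undefined))(i := int i) = \<tau>" by auto
  show "(\<lambda>\<sigma>. \<sigma>(i := int i)) ` derangements_on (A - {i}) \<subseteq> ?Y"
  proof (rule image_subsetI)
    fix \<sigma> assume d: "\<sigma> \<in> derangements_on (A - {i})"
    then have s: "\<sigma> \<in> signed_perms_on (A - {i})" by (simp add: derangements_on_def)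
    note D = signed_perms_onD[OF s]
    have ne: "\<bar>\<sigma> k\<bar> \<noteq> int i" if "k \<in> A - {i}" for k
      using D(1)[OF that] by auto
    have "\<sigma>(i := int i) \<in> signed_perms_on A"
    proof (rule signed_perms_onI[OF fin])
      show "nat \<bar>(\<sigma>(i := int i)) k\<bar> \<in> A" if "k \<in> A" for k
        using that D(1)[of k] i by auto
      show "(\<sigma>(i := int i)) k = undefined" if "k \<notin> A" for k
        using that D(2)[of k] i by auto
      show "k = l" if "k \<in> A" "l \<in> A" "\<bar>(\<sigma>(i := int i)) k\<bar> = \<bar>(\<sigma>(i := int i)) l\<bar>" for k l
        using that D(3)[of k l] ne[of k] ne[of l] by (auto split: if_splits)
    qed
    then show "\<sigma>(i := int i) \<in> ?Y" using d by (auto simp: derangements_on_def)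
  qed
  show "(\<lambda>\<tau>. \<tau>(i := undefined)) ` ?Y \<subseteq> derangements_on (A - {i})"
  proof (rule image_subsetI)
    fix \<tau> assume y: "\<tau> \<in> ?Y"
    then have s: "\<tau> \<in> signed_perms_on A" by simp
    note D = signed_perms_onD[OF s]
    have "\<tau>(i := undefined) \<in> signed_perms_on (A - {i})"
    proof (rule signed_perms_onI)
      show "finite (A - {i})" using fin by simp
      show "nat \<bar>(\<tau>(i := undefined)) k\<bar> \<in> A - {i}" if "k \<in> A - {i}" for k
        using that D(1)[of k] D(3)[of k i] i y by auto
      show "(\<tau>(i := undefined)) k = undefined" if "k \<notin> A - {i}" for k
        using that D(2) by auto
      show "k = l" if "k \<in> A - {i}" "l \<in> A - {i}"
        "\<bar>(\<tau>(i := undefined)) k\<bar> = \<bar>(\<tau>(i := undefined)) l\<bar>" for k l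
        using that D(3)[of k l] by (auto split: if_splits)
    qed
    then show "\<tau>(i := undefined) \<in> derangements_on (A - {i})"
      using y by (auto simp: derangements_on_def)
  qed
qed

text \<open>Words with \<open>\<bar>\<tau> m\<bar> = m\<close> contribute
  \<open>q * exc_poly A\<close>. All others arise by insertion: the two signs of \<open>m\<close>
  give the factor \<open>2 * q\<close>, and the remaining weight counts the excedances of
  \<open>\<sigma>\<close> other than \<open>i\<close>. The sum over \<open>i\<close> splits
  according to whether \<open>\<sigma>\<close> fixes \<open>i\<close>.\<close>

lemma exc_poly_insert:
  assumes fin: "finite A" and A: "\<And>k. k \<in> A \<Longrightarrow> 0 < k \<and> k < m" and m: "0 < m"
  defines "q \<equiv> monom (1::real) 1"
  shows "exc_poly (insert m A) =
    of_nat (2 * card A + 1) * q * exc_poly A + 2 * q * (1 - q) * pderiv (exc_poly A)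
      + 2 * q * (\<Sum>i\<in>A. exc_poly (A - {i}))"
proof -
  have mA: "m \<notin> A" using A by blast
  let ?D = "derangements_on (insert m A)"
  let ?w = "\<lambda>\<tau>. monom (1::real) (card (excedances (insert m A) \<tau>))"
  let ?X1 = "{\<tau> \<in> ?D. \<bar>\<tau> m\<bar> = int m}" and ?X2 = "{\<tau> \<in> ?D. \<bar>\<tau> m\<bar> \<noteq> int m}"
  have q_monom: "monom 1 (Suc k) = q * monom 1 k" for k
    by (simp add: q_def mult_monom)
  have finD: "finite ?D" using fin by (simp add: finite_derangements_on)
  have "exc_poly (insert m A) = sum ?w ?X1 + sum ?w ?X2"
    unfolding exc_poly_def
    by (subst sum.union_disjoint[symmetric]) (use finD in \<open>auto intro!: sum.cong\<close>)
  moreover have "sum ?w ?X1 = q * exc_poly A"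
  proof -
    have "sum ?w ?X1 = (\<Sum>\<sigma>\<in>derangements_on A. ?w (\<sigma>(m := - int m)))"
      by (rule sum.reindex_bij_betw[OF derangements_on_insert_fixed[OF fin A m], symmetric])
    also have "\<dots> = (\<Sum>\<sigma>\<in>derangements_on A. q * monom 1 (card (excedances A \<sigma>)))"
    proof (rule sum.cong[OF refl])
      fix \<sigma> assume "\<sigma> \<in> derangements_on A"
      have im: "(\<sigma>(m := - int m)) ` insert m A = insert (- int m) (\<sigma> ` A)" using mA by auto
      have "excedances (insert m A) (\<sigma>(m := - int m)) = insert m (excedances A \<sigma>)"
        unfolding excedances_def im using mA by auto
      moreover have "m \<notin> excedances A \<sigma>" using mA by (simp add: excedances_def)
      ultimately show "?w (\<sigma>(m := - int m)) = q * monom 1 (card (excedances A \<sigma>))"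
        using finite_excedances[OF fin] by (simp add: q_monom)
    qed
    finally show ?thesis by (simp add: exc_poly_def sum_distrib_left)
  qed
  moreover have "sum ?w ?X2 = 2 * q * (of_nat (card A) * exc_poly A + (1 - q) * pderiv (exc_poly A)
      + (\<Sum>i\<in>A. exc_poly (A - {i})))"
  proof -
    let ?f = "\<lambda>(i, v, \<sigma>). \<sigma>(m := \<sigma> i, i := v) :: nat \<Rightarrow> int"
    let ?V = "{int m, - int m}"
    \<comment> \<open>\<open>W i\<close> tolerates a fixed point at \<open>i\<close>, which the
      insertion removes; \<open>F i\<close> collects the words of \<open>W i\<close> where it is
      present.\<close>
    define W where "W i = {\<sigma> \<in> signed_perms_on A. \<forall>k\<in>A - {i}. \<sigma> k \<noteq> int k}" for i
    define F where "F i = {\<sigma> \<in> signed_perms_on A. (\<forall>k\<in>A - {i}. \<sigma> k \<noteq> int k) \<and> \<sigma> i = int i}" for i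
    have finW: "finite (W i)" for i
      using finite_signed_perms_on[OF fin] by (simp add: W_def)
    let ?u = "\<lambda>i \<sigma>. monom (1::real) (card (excedances A \<sigma> - {i}))"
    \<comment> \<open>After insertion, \<open>i\<close> carries \<open>\<plusminus>m\<close> and
      \<open>m\<close> carries an entry of smaller absolute value, so neither is fixed and only the
      other letters matter.\<close>
    have "bij_betw ?f {x \<in> A \<times> ?V \<times> signed_perms_on A. case x of (i, v, \<sigma>) \<Rightarrow> \<forall>k\<in>A - {i}. \<sigma> k \<noteq> int k}
       {\<tau> \<in> {\<tau> \<in> signed_perms_on (insert m A). \<bar>\<tau> m\<bar> \<noteq> int m}. \<forall>k\<in>insert m A. \<tau> k \<noteq> int k}"
    proof (rule bij_betw_Collect[OF bij_betw_insert_value[OF fin A]])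
      fix x assume "x \<in> A \<times> ?V \<times> signed_perms_on A"
      then obtain i v \<sigma> where x: "x = (i, v, \<sigma>)"
        and i: "i \<in> A" and v: "v \<in> ?V" and s: "\<sigma> \<in> signed_perms_on A" by blast
      have "\<bar>\<sigma> i\<bar> < int m"
        using A[OF signed_perms_onD(1)[OF s i]] by linarith
      then show "(\<forall>k\<in>insert m A. ?f x k \<noteq> int k) \<longleftrightarrow>
          (case x of (i, v, \<sigma>) \<Rightarrow> \<forall>k\<in>A - {i}. \<sigma> k \<noteq> int k)"
        using x i v mA A[OF i] by auto
    qed auto
    also have "{x \<in> A \<times> ?V \<times> signed_perms_on A. case x of (i, v, \<sigma>) \<Rightarrow> \<forall>k\<in>A - {i}. \<sigma> k \<noteq> int k}
        = (SIGMA i:A. ?V \<times> W i)"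
      by (auto simp: W_def)
    also have "{\<tau> \<in> {\<tau> \<in> signed_perms_on (insert m A). \<bar>\<tau> m\<bar> \<noteq> int m}. \<forall>k\<in>insert m A. \<tau> k \<noteq> int k} = ?X2"
      by (auto simp: derangements_on_def)
    finally have "sum ?w ?X2 = (\<Sum>x\<in>(SIGMA i:A. ?V \<times> W i). ?w (?f x))"
      by (rule sum.reindex_bij_betw[symmetric])
    also have "\<dots> = (\<Sum>(i, v, \<sigma>)\<in>(SIGMA i:A. ?V \<times> W i). q * ?u i \<sigma>)"
    proof (rule sum.cong[OF refl], clarify)
      fix i v \<sigma> assume i: "i \<in> A" and v: "v \<in> ?V" and "\<sigma> \<in> W i"
      then have s: "\<sigma> \<in> signed_perms_on A" by (simp add: W_def)
      show "monom 1 (card (excedances (insert m A) (\<sigma>(m := \<sigma> i, i := v)))) = q * ?u i \<sigma>"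
        by (subst card_excedances_insert_value[OF fin s i v A]) (simp_all add: q_monom)
    qed
    also have "\<dots> = (\<Sum>i\<in>A. \<Sum>(v, \<sigma>)\<in>?V \<times> W i. q * ?u i \<sigma>)"
      using fin finW by (subst sum.Sigma) (simp_all add: split_def)
    also have "\<dots> = (\<Sum>i\<in>A. 2 * q * (\<Sum>\<sigma>\<in>W i. ?u i \<sigma>))"
    proof (rule sum.cong[OF refl])
      fix i
      have "(\<Sum>(v, \<sigma>)\<in>?V \<times> W i. q * ?u i \<sigma>) = (\<Sum>v\<in>?V. \<Sum>\<sigma>\<in>W i. q * ?u i \<sigma>)"
        by (rule sum.cartesian_product[symmetric])
      then show "(\<Sum>(v, \<sigma>)\<in>?V \<times> W i. q * ?u i \<sigma>) = 2 * q * (\<Sum>\<sigma>\<in>W i. ?u i \<sigma>)"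
        using m by (simp add: sum_distrib_left mult.assoc)
    qed
    also have "\<dots> = 2 * q * (\<Sum>i\<in>A. \<Sum>\<sigma>\<in>W i. ?u i \<sigma>)"
      by (simp add: sum_distrib_left)
    also have "(\<Sum>i\<in>A. \<Sum>\<sigma>\<in>W i. ?u i \<sigma>) = (\<Sum>i\<in>A. (\<Sum>\<sigma>\<in>derangements_on A. ?u i \<sigma>) + exc_poly (A - {i}))"
    proof (rule sum.cong[OF refl])
      fix i assume i: "i \<in> A"
      have "W i = derangements_on A \<union> F i" "derangements_on A \<inter> F i = {}"
        using i by (auto simp: W_def F_def derangements_on_def)
      moreover have "finite (F i)" using finite_signed_perms_on[OF fin] by (simp add: F_def)
      ultimately have "(\<Sum>\<sigma>\<in>W i. ?u i \<sigma>) = (\<Sum>\<sigma>\<in>derangements_on A. ?u i \<sigma>) + (\<Sum>\<sigma>\<in>F i. ?u i \<sigma>)"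
        using finite_derangements_on[OF fin] by (simp add: sum.union_disjoint)
      moreover have "(\<Sum>\<sigma>\<in>F i. ?u i \<sigma>) = (\<Sum>\<sigma>\<in>derangements_on (A - {i}). ?u i (\<sigma>(i := int i)))"
        unfolding F_def
        by (rule sum.reindex_bij_betw[OF derangements_on_remove_fixed[OF fin i], symmetric])
      moreover have "\<dots> = exc_poly (A - {i})"
        unfolding exc_poly_def
      proof (rule sum.cong[OF refl])
        fix \<sigma> assume "\<sigma> \<in> derangements_on (A - {i})"
        have im: "(\<sigma>(i := int i)) ` A = insert (int i) (\<sigma> ` (A - {i}))" using i by auto
        have "excedances A (\<sigma>(i := int i)) - {i} = excedances (A - {i}) \<sigma>"
          unfolding excedances_def im using i by auto
        then show "?u i (\<sigma>(i := int i)) = monom 1 (card (excedances (A - {i}) \<sigma>))" by simp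
      qed
      ultimately show "(\<Sum>\<sigma>\<in>W i. ?u i \<sigma>) = (\<Sum>\<sigma>\<in>derangements_on A. ?u i \<sigma>) + exc_poly (A - {i})"
        by simp
    qed
    also have "\<dots> = (\<Sum>\<sigma>\<in>derangements_on A. \<Sum>i\<in>A. ?u i \<sigma>) + (\<Sum>i\<in>A. exc_poly (A - {i}))"
      unfolding sum.distrib by (subst sum.swap) (rule refl)
    also have "(\<Sum>\<sigma>\<in>derangements_on A. \<Sum>i\<in>A. ?u i \<sigma>) =
      (\<Sum>\<sigma>\<in>derangements_on A. of_nat (card A) * monom 1 (card (excedances A \<sigma>)) +
         (1 - q) * pderiv (monom 1 (card (excedances A \<sigma>))))"
    proof (rule sum.cong[OF refl])
      fix \<sigma>
      let ?E = "excedances A \<sigma>"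
      have E: "finite ?E" "?E \<subseteq> A" using finite_excedances[OF fin] by (auto simp: excedances_def)
      \<comment> \<open>With \<open>e = card ?E\<close> this is \<open>e * q^e = q * (q^e)'\<close>;
        for \<open>e = 0\<close>, where \<open>e - 1\<close> is truncated, both sides are
        zero.\<close>
      have qE: "of_nat (card ?E) * monom (1::real) (card ?E) = q * pderiv (monom 1 (card ?E))"
        by (cases "card ?E") (simp_all add: q_def pderiv_monom mult_monom of_nat_poly smult_monom)
      \<comment> \<open>Deleting \<open>i\<close> lowers the exponent exactly when \<open>i\<close>
        is an excedance: \<open>e\<close> letters give \<open>q^(e-1)\<close> each, the other
        \<open>card A - e\<close> give \<open>q^e\<close>.\<close>
      have "(\<Sum>i\<in>A. ?u i \<sigma>) = (\<Sum>i\<in>?E. ?u i \<sigma>) + (\<Sum>i\<in>A - ?E. ?u i \<sigma>)"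
        using sum.subset_diff[OF E(2) fin, of "\<lambda>i. ?u i \<sigma>"] by (simp add: add.commute)
      also have "(\<Sum>i\<in>?E. ?u i \<sigma>) = (\<Sum>i\<in>?E. monom 1 (card ?E - 1))"
        using E by (intro sum.cong) auto
      also have "\<dots> = pderiv (monom 1 (card ?E))"
        by (simp add: pderiv_monom of_nat_poly smult_monom)
      also have "(\<Sum>i\<in>A - ?E. ?u i \<sigma>) = (\<Sum>i\<in>A - ?E. monom 1 (card ?E))"
        by (intro sum.cong) auto
      also have "\<dots> = (of_nat (card A) - of_nat (card ?E)) * monom 1 (card ?E)"
        using E fin by (simp add: card_Diff_subset card_mono)
      also have "pderiv (monom 1 (card ?E)) + (of_nat (card A) - of_nat (card ?E)) * monom 1 (card ?E) =
        of_nat (card A) * monom (1::real) (card ?E) + (1 - q) * pderiv (monom 1 (card ?E))"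
        using qE by (simp add: algebra_simps)
      finally show "(\<Sum>i\<in>A. ?u i \<sigma>) = of_nat (card A) * monom 1 (card ?E) +
         (1 - q) * pderiv (monom 1 (card ?E))" .
    qed
    also have "\<dots> = of_nat (card A) * exc_poly A + (1 - q) * pderiv (exc_poly A)"
      by (simp add: exc_poly_def sum.distrib sum_distrib_left higher_pderiv_sum[of 1, simplified])
    finally show ?thesis .
  qed
  ultimately show ?thesis by (simp add: algebra_simps)
qed

text \<open>By strong induction, the recurrence obtained by removing the maximum depends on the set
  only through its size, so \<open>A\<close> and \<open>{1..card A}\<close> have the same
  polynomial.\<close>

lemma exc_poly_eq_derangement_poly_B:
  assumes "finite A" "0 \<notin> A"
  shows "exc_poly A = derangement_poly_B (card A)"
  using assms
proof (induction "card A" arbitrary: A rule: less_induct)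
  case less
  show ?case
  proof (cases "A = {}")
    case True
    then show ?thesis using exc_poly_atLeastAtMost[of 0] by simp
  next
    case False
    \<comment> \<open>Stated for every \<open>B\<close> of the size of \<open>A\<close>, to be used
      for \<open>A\<close> and for \<open>{1..card A}\<close>. When \<open>card A = 1\<close>, the
      truncated \<open>card A - 2\<close> occurs with coefficient zero.\<close>
    have step: "exc_poly B = of_nat (2 * card A - 1) * monom 1 1 * derangement_poly_B (card A - 1)
        + 2 * monom 1 1 * (1 - monom 1 1) * pderiv (derangement_poly_B (card A - 1))
        + 2 * monom 1 1 * (of_nat (card A - 1) * derangement_poly_B (card A - 2))"
      if B: "finite B" "0 \<notin> B" "card B = card A" for B
    proof -
      have "B \<noteq> {}" using B False less.prems by auto
      define m where "m = Max B"
      have mB: "m \<in> B" using \<open>B \<noteq> {}\<close> B(1) by (simp add: m_def)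
      define C where "C = B - {m}"
      have BC: "B = insert m C" using mB by (auto simp: C_def)
      have C: "finite C" "0 \<notin> C" using B by (auto simp: C_def)
      have cC: "card C = card A - 1" using B mB by (simp add: C_def)
      have lt: "card C < card A" 
        unfolding C_def B(3)[symmetric] using B(1) mB by (rule card_Diff1_less)
      have "\<And>k. k \<in> C \<Longrightarrow> 0 < k \<and> k < m"
        using C(2) B(1) by (auto simp: C_def m_def le_neq_implies_less intro: gr0I)
      moreover have "0 < m" using mB B(2) by (auto intro: gr0I)
      ultimately have "exc_poly B = of_nat (2 * card C + 1) * monom 1 1 * exc_poly C
          + 2 * monom 1 1 * (1 - monom 1 1) * pderiv (exc_poly C)
          + 2 * monom 1 1 * (\<Sum>i\<in>C. exc_poly (C - {i}))"
        unfolding BC by (rule exc_poly_insert[OF C(1)])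
      also have "exc_poly C = derangement_poly_B (card A - 1)"
        using less.hyps[OF lt C] cC by simp
      also have "(\<Sum>i\<in>C. exc_poly (C - {i})) = (\<Sum>i\<in>C. derangement_poly_B (card A - 2))"
      proof (rule sum.cong[OF refl])
        fix i assume "i \<in> C"
        then have "card (C - {i}) = card A - 2" using C(1) cC by simp
        moreover have "card (C - {i}) < card A" using lt card_Diff1_le[of C i] by linarith
        ultimately show "exc_poly (C - {i}) = derangement_poly_B (card A - 2)"
          using less.hyps[of "C - {i}"] C by simp
      qed
      also have "2 * card C + 1 = 2 * card A - 1" using lt cC by linarith
      finally show ?thesis using cC by simp
    qed
    have "exc_poly A = exc_poly {1..card A}"
      using step[of A] step[of "{1..card A}"] less.prems by simp
    then show ?thesis by (simp only: exc_poly_atLeastAtMost)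
  qed
qed

text \<open>Each of the \<open>n\<close> sets \<open>{1..n} - {i}\<close> has \<open>n - 1\<close>
  letters, whence the last term; for \<open>n = 0\<close> its coefficient vanishes, so the truncated
  index is harmless.\<close>

lemma derangement_poly_B_rec:
  defines "q \<equiv> monom (1::real) 1"
  shows "derangement_poly_B (Suc n) =
    of_nat (2 * n + 1) * q * derangement_poly_B n + 2 * q * (1 - q) * pderiv (derangement_poly_B n)
      + of_nat (2 * n) * q * derangement_poly_B (n - 1)"
proof -
  have "derangement_poly_B (Suc n) = exc_poly (insert (Suc n) {1..n})"
    using exc_poly_atLeastAtMost[of "Suc n"] by (simp add: atLeastAtMostSuc_conv)
  also have "\<dots> = of_nat (2 * card {1..n} + 1) * q * exc_poly {1..n}
      + 2 * q * (1 - q) * pderiv (exc_poly {1..n}) + 2 * q * (\<Sum>i\<in>{1..n}. exc_poly ({1..n} - {i}))"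
    unfolding q_def by (rule exc_poly_insert) auto
  also have "(\<Sum>i\<in>{1..n}. exc_poly ({1..n} - {i})) = (\<Sum>i\<in>{1..n}. derangement_poly_B (n - 1))"
    by (intro sum.cong) (auto simp: exc_poly_eq_derangement_poly_B)
  finally show ?thesis
    unfolding exc_poly_atLeastAtMost by (simp add: algebra_simps)
qed

subsection \<open>Interlacing roots\<close>

lemma sgn_prod_diff:
  fixes x :: real
  assumes "finite J" "\<And>j. j \<in> J \<Longrightarrow> r j \<noteq> x"
  shows "sgn (\<Prod>j\<in>J. x - r j) = (- 1) ^ card {j \<in> J. x < r j}"
  using assms
proof (induction J rule: finite_induct)
  case empty
  then show ?case by simp
next
  case (insert a J)
  have "{j \<in> insert a J. x < r j} =
      (if x < r a then insert a {j \<in> J. x < r j} else {j \<in> J. x < r j})" by auto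
  moreover have "sgn (x - r a) = (if x < r a then - 1 else 1)"
    using insert.prems[of a] by (auto simp: sgn_if)
  ultimately show ?case using insert by (simp add: sgn_mult)
qed

text \<open>In the product rule, the part that keeps the factor at \<open>i\<close> vanishes at
  \<open>r i\<close>.\<close>

lemma poly_pderiv_prod_root:
  fixes r :: "'i \<Rightarrow> real"
  assumes "finite J" "i \<in> J"
  shows "poly (pderiv (\<Prod>j\<in>J. [:- r j, 1:])) (r i) = (\<Prod>j\<in>J - {i}. r i - r j)"
proof -
  have "(\<Prod>j\<in>J. [:- r j, 1:]) = [:- r i, 1:] * (\<Prod>j\<in>J - {i}. [:- r j, 1:])"
    using assms by (rule prod.remove)
  then show ?thesis by (simp only: pderiv_mult poly_add poly_mult) (simp add: poly_prod pderiv_pCons)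
qed

text \<open>The difference of two monic polynomials of degree \<open>n\<close>, if nonzero, has
  degree below \<open>n\<close> and cannot have \<open>n\<close> distinct roots.\<close>

lemma monic_eq_prod_roots:
  fixes f :: "real poly"
  assumes "degree f = n" "lead_coeff f = 1" "\<And>i. i < n \<Longrightarrow> poly f (r i) = 0" "inj_on r {..<n}"
  shows "f = (\<Prod>i<n. [:- r i, 1:])"
proof (rule ccontr)
  let ?g = "\<Prod>i<n. [:- r i, 1:]"
  assume ne: "f \<noteq> ?g"
  have dg: "degree ?g = n" by (subst degree_prod_eq_sum_degree) auto
  have lg: "lead_coeff ?g = 1" by (simp add: lead_coeff_prod)
  have nz: "f - ?g \<noteq> 0" using ne by simp
  have "coeff (f - ?g) n = 0" using assms(1,2) dg lg by simp
  moreover have "degree (f - ?g) \<le> n" using assms(1) dg by (metis degree_diff_le order_refl)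
  ultimately have "degree (f - ?g) < n"
    using nz by (metis leading_coeff_0_iff le_neq_implies_less)
  moreover have "r ` {..<n} \<subseteq> {x. poly (f - ?g) x = 0}"
    using assms(3) by (auto simp: poly_prod prod_zero_iff)
  then have "card (r ` {..<n}) \<le> card {x. poly (f - ?g) x = 0}"
    by (intro card_mono poly_roots_finite nz)
  then have "n \<le> card {x. poly (f - ?g) x = 0}" using card_image[OF assms(4)] by simp
  moreover have "card {x. poly (f - ?g) x = 0} \<le> degree (f - ?g)" by (rule card_poly_roots_bound[OF nz])
  ultimately show False by simp
qed

lemma ex_sgn_poly_below:
  fixes f :: "real poly"
  assumes "lead_coeff f = 1"
  shows "\<exists>x < b. sgn (poly f x) = (- 1) ^ degree f"
proof -
  \<comment> \<open>Reflecting the variable moves the behaviour at minus infinity to plus infinity,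
    and the sign factor makes the leading coefficient \<open>1\<close> again.\<close>
  define g where "g = smult ((- 1) ^ degree f) (f \<circ>\<^sub>p [:0, - 1:])"
  have "lead_coeff g = 1"
    using assms by (simp add: g_def lead_coeff_comp flip: power_mult_distrib)
  then obtain N where N: "\<And>x. x \<ge> N \<Longrightarrow> poly g x \<ge> 1"
    using poly_pinfty_gt_lc[of g] by auto
  define x where "x = - (max N (1 - b))"
  have "poly g (- x) \<ge> 1" by (rule N) (simp add: x_def)
  then have "sgn ((- 1) ^ degree f * poly f x) = 1" by (simp add: g_def poly_pcompose)
  then have "(- 1) ^ degree f * sgn (poly f x) = 1" by (cases "even (degree f)") (simp_all add: sgn_mult)
  then have "sgn (poly f x) = (- 1) ^ degree f" by (cases "even (degree f)") auto
  then show ?thesis by (intro exI[of _ x]) (auto simp: x_def)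
qed

text \<open>Strict, in contrast to \<open>interlaces\<close>, because it serves polynomials from
  which the shared root \<open>0\<close> has been divided out.\<close>

definition strictly_interlacing :: "nat \<Rightarrow> (nat \<Rightarrow> real) \<Rightarrow> (nat \<Rightarrow> real) \<Rightarrow> bool" where
  "strictly_interlacing n s r \<longleftrightarrow> (\<forall>i<n. r i < s i \<and> s i < r (Suc i))"

lemma strictly_interlacing_less:
  assumes "strictly_interlacing n s r" "i < j" "j \<le> n"
  shows "r i < r j"
  using assms(2,3)
proof (induction j rule: less_induct)
  case (less j)
  then obtain k where k: "j = Suc k" by (cases j) auto
  have "r k < r (Suc k)" using assms(1) less k unfolding strictly_interlacing_def
    by (meson Suc_le_lessD less_trans)
  then show ?case using less k by (cases "i = k") (auto intro: less_trans[of _ "r k"])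
qed

lemma strictly_interlacing_less_right:
  assumes "strictly_interlacing n s r" "i \<le> j" "j < n"
  shows "r i < s j"
proof -
  have "r i \<le> r j" using strictly_interlacing_less[OF assms(1), of i j] assms by (cases "i = j") auto
  moreover have "r j < s j" using assms by (auto simp: strictly_interlacing_def)
  ultimately show ?thesis by linarith
qed

lemma strictly_interlacing_less_left:
  assumes "strictly_interlacing n s r" "j < i" "i \<le> n"
  shows "s j < r i"
proof -
  have "r (Suc j) \<le> r i"
    using strictly_interlacing_less[OF assms(1), of "Suc j" i] assms by (cases "Suc j = i") auto
  moreover have "s j < r (Suc j)" using assms by (auto simp: strictly_interlacing_def)
  ultimately show ?thesis by linarith
qed

text \<open>At \<open>r i\<close> both \<open>f\<close> and \<open>pderiv g\<close> have sign
  \<open>(-1)^(n-i)\<close>, so \<open>rel\<close> gives \<open>h\<close> the opposite sign. With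
  \<open>lc\<close> fixing the sign far to the left and \<open>pos\<close> the sign at
  \<open>0\<close>, the intermediate value theorem finds \<open>n + 2\<close> roots in disjoint
  intervals, all that the degree permits.\<close>

lemma interlacing_step:
  fixes f g h :: "real poly"
  assumes f: "f = (\<Prod>i<n. [:- s i, 1:])" and g: "g = (\<Prod>i<Suc n. [:- r i, 1:])"
    and il: "strictly_interlacing n s r" and neg: "\<And>i. i \<le> n \<Longrightarrow> r i < 0"
    and deg: "degree h = Suc (Suc n)" and lc: "lead_coeff h = 1" and pos: "poly h 0 > 0"
    and rel: "\<And>x. poly g x = 0 \<Longrightarrow> x < 0 \<Longrightarrow>
       \<exists>a b. a > 0 \<and> b > 0 \<and> poly h x = - (a * poly (pderiv g) x + b * poly f x)"
  shows "\<exists>t. h = (\<Prod>i<Suc (Suc n). [:- t i, 1:]) \<and> strictly_interlacing (Suc n) r t \<and>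
    (\<forall>i\<le>Suc n. t i < 0)"
proof -
  note mono = strictly_interlacing_less[OF il]
    and mono_s = strictly_interlacing_less_right[OF il]
    and mono_s' = strictly_interlacing_less_left[OF il]
  have sgn_h: "sgn (poly h (r i)) = (- 1) ^ Suc (n - i)" if i: "i \<le> n" for i
  proof -
    have "s j \<noteq> r i" if "j < n" for j
      using mono_s[of i j] mono_s'[of j i] that i by (cases "i \<le> j") auto
    then have "sgn (\<Prod>j<n. r i - s j) = (- 1) ^ card {j \<in> {..<n}. r i < s j}"
      by (intro sgn_prod_diff) auto
    then have "sgn (poly f (r i)) = (- 1) ^ card {j \<in> {..<n}. r i < s j}"
      by (simp add: f poly_prod)
    \<comment> \<open>Exactly \<open>n - i\<close> roots of \<open>f\<close> exceed
      \<open>r i\<close>, and below the same number of roots of \<open>g\<close> do, which is why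
      the two signs agree.\<close>
    also have "{j \<in> {..<n}. r i < s j} = {i..<n}"
      using mono_s[of i] mono_s'[of _ i] i by (force simp: not_less)
    finally have sf: "sgn (poly f (r i)) = (- 1) ^ (n - i)" by simp
    have inj: "r j \<noteq> r i" if "j \<le> n" "j \<noteq> i" for j
      using mono[of i j] mono[of j i] that i by (cases "i < j") auto
    have "sgn (poly (pderiv g) (r i)) = sgn (\<Prod>j\<in>{..<Suc n} - {i}. r i - r j)"
      unfolding g using i by (subst poly_pderiv_prod_root) auto
    also have "\<dots> = (- 1) ^ card {j \<in> {..<Suc n} - {i}. r i < r j}"
      using inj by (intro sgn_prod_diff) auto
    also have "{j \<in> {..<Suc n} - {i}. r i < r j} = {i<..n}"
    proof -
      have "i < j" if "r i < r j" "j \<le> n" for j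
        using mono[of j i] that i by (cases j i rule: linorder_cases) auto
      then show ?thesis using mono[of i] by auto
    qed
    finally have sg: "sgn (poly (pderiv g) (r i)) = (- 1) ^ (n - i)" by simp
    have "poly g (r i) = 0" unfolding g poly_prod using i by (intro prod_zero) (auto intro: bexI[of _ i])
    then obtain a b where ab: "a > 0" "b > 0"
      "poly h (r i) = - (a * poly (pderiv g) (r i) + b * poly f (r i))"
      using rel[of "r i"] neg[OF i] by blast
    show ?thesis
    proof (cases "even (n - i)")
      case True
      then have "poly (pderiv g) (r i) > 0" "poly f (r i) > 0" using sf sg by (auto simp: sgn_1_pos)
      then have "a * poly (pderiv g) (r i) + b * poly f (r i) > 0"
        using ab by (intro add_pos_pos mult_pos_pos)
      then show ?thesis using ab(3) True by (simp add: sgn_neg)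
    next
      case False
      then have "poly (pderiv g) (r i) < 0" "poly f (r i) < 0" using sf sg by (auto simp: sgn_1_neg)
      then have "a * poly (pderiv g) (r i) + b * poly f (r i) < 0"
        using ab by (intro add_neg_neg mult_pos_neg)
      then show ?thesis using ab(3) False by simp
    qed
  qed
  obtain M where M: "M < r 0" "sgn (poly h M) = (- 1) ^ Suc (Suc n)"
    using ex_sgn_poly_below[OF lc] deg by auto
  \<comment> \<open>The \<open>n + 3\<close> points \<open>M, r 0, ..., r n, 0\<close> bound
    \<open>n + 2\<close> consecutive intervals; the index shift makes room for
    \<open>M\<close>.\<close>
  define p where "p i = (if i = 0 then M else if i = Suc (Suc n) then 0 else r (i - 1))" for i
  have sgn_p: "sgn (poly h (p i)) = (- 1) ^ (Suc (Suc n) - i)" if "i \<le> Suc (Suc n)" for i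
  proof -
    consider "i = 0" | "i = Suc (Suc n)" | k where "i = Suc k" "k \<le> n"
      using \<open>i \<le> Suc (Suc n)\<close> by (metis Suc_le_mono le_SucE not0_implies_Suc)
    then show ?thesis
      using M(2) pos sgn_h by cases (auto simp: p_def Suc_diff_le)
  qed
  have p_less: "p i < p (Suc i)" if "i \<le> Suc n" for i
    using that M(1) neg[of n] mono[of "i - 1" i] by (auto simp: p_def)
  have "\<exists>x. p i < x \<and> x < p (Suc i) \<and> poly h x = 0" if i: "i \<le> Suc n" for i
  proof (rule poly_IVT[OF p_less[OF i]])
    have *: "sgn (poly h (p i) * poly h (p (Suc i))) = - 1"
      using sgn_p[of i] sgn_p[of "Suc i"] i
      by (simp add: sgn_mult Suc_diff_le flip: power_add)
    then show "poly h (p i) * poly h (p (Suc i)) < 0" by (simp only: sgn_1_neg)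
  qed
  then obtain t where t: "\<And>i. i \<le> Suc n \<Longrightarrow> p i < t i \<and> t i < p (Suc i) \<and> poly h (t i) = 0"
    by metis
  \<comment> \<open>\<open>r i\<close> is \<open>p (Suc i)\<close>, the common endpoint of the
    intervals holding \<open>t i\<close> and \<open>t (Suc i)\<close>.\<close>
  have ilt: "strictly_interlacing (Suc n) r t"
    unfolding strictly_interlacing_def
  proof (intro allI impI)
    fix i assume i: "i < Suc n"
    then show "t i < r i \<and> r i < t (Suc i)" using t[of i] t[of "Suc i"] by (auto simp: p_def)
  qed
  have "inj_on t {..<Suc (Suc n)}"
  proof (rule linorder_inj_onI)
    fix i j assume "i < j" "i \<in> {..<Suc (Suc n)}" "j \<in> {..<Suc (Suc n)}"
    then show "t i \<noteq> t j" using strictly_interlacing_less[OF ilt, of i j] by auto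
  qed auto
  then have "h = (\<Prod>i<Suc (Suc n). [:- t i, 1:])"
    using t by (intro monic_eq_prod_roots deg lc) auto
  moreover have "t i < 0" if "i \<le> Suc n" for i
  proof -
    have "t i \<le> t (Suc n)" using strictly_interlacing_less[OF ilt, of i "Suc n"] that
      by (cases "i = Suc n") auto
    also have "\<dots> < 0" using t[of "Suc n"] by (simp add: p_def)
    finally show ?thesis .
  qed
  ultimately show ?thesis using ilt by blast
qed

subsection \<open>The polynomials \<open>d\<^sub>n\<^sub>+\<^sub>1 / q\<close>\<close>

text \<open>This is \<open>e\<^sub>n\<close>: substitute
  \<open>d\<^sub>n\<^sub>+\<^sub>1 = q e\<^sub>n\<close> in the recurrence and cancel
  \<open>q\<close>. The last term keeps \<open>d\<^sub>n\<close> instead of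
  \<open>q e\<^sub>n\<^sub>-\<^sub>1\<close>, which covers \<open>d\<^sub>0 = 1\<close>, not a
  multiple of \<open>q\<close>.\<close>

primrec reduced_poly :: "nat \<Rightarrow> real poly" where
  "reduced_poly 0 = 1"
| "reduced_poly (Suc n) =
     smult (real (2 * n + 1)) (pCons 0 (reduced_poly n)) + smult 2 (reduced_poly n)
     + smult 2 (pCons 0 (pderiv (reduced_poly n) - pCons 0 (pderiv (reduced_poly n))))
     + smult (real (2 * n + 2)) (derangement_poly_B n)"

lemma derangement_poly_B_0: "derangement_poly_B 0 = 1"
  by (simp add: derangement_poly_B_def)

lemma derangement_poly_B_Suc: "derangement_poly_B (Suc n) = pCons 0 (reduced_poly n)"
proof (induction n)
  case 0
  show ?case
    by (simp add: derangement_poly_B_rec derangement_poly_B_0 monom_altdef)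
next
  case (Suc n)
  have q: "monom 1 1 = [:0, 1::real:]" by (simp add: monom_altdef)
  have *: "of_nat k = [:real k:]" for k by (simp add: of_nat_poly)
  show ?case
    unfolding derangement_poly_B_rec[of "Suc n"] Suc.IH q *
    by (intro poly_eqI)
      (simp add: pderiv_pCons coeff_pCons coeff_pderiv numeral_poly algebra_simps split: nat.split)
qed

lemma coeff_reduced_poly_Suc:
  "coeff (reduced_poly (Suc n)) (Suc k) =
     (2 * real n + 1 - 2 * real k) * coeff (reduced_poly n) k
     + 2 * (real k + 2) * coeff (reduced_poly n) (Suc k)
     + (2 * real n + 2) * coeff (derangement_poly_B n) (Suc k)"
  by (cases k) (simp_all add: coeff_pderiv algebra_simps)

text \<open>For \<open>k = n\<close> the first factor in \<open>coeff_reduced_poly_Suc\<close> is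
  \<open>1\<close> and the other terms vanish, so the polynomials stay monic. The bound on
  \<open>derangement_poly_B n\<close> is carried along since that polynomial enters the
  recursion.\<close>

lemma coeff_reduced_poly:
  "coeff (reduced_poly n) n = 1 \<and> (\<forall>k>n. coeff (reduced_poly n) k = 0) \<and>
    (\<forall>k>n. coeff (derangement_poly_B n) k = 0)"
proof (induction n)
  case 0
  show ?case by (auto simp: derangement_poly_B_0)
next
  case (Suc n)
  have "coeff (reduced_poly (Suc n)) (Suc k) = 0" if "k > n" for k
    unfolding coeff_reduced_poly_Suc using that Suc by simp
  then have "\<forall>k>Suc n. coeff (reduced_poly (Suc n)) k = 0" by (metis Suc_less_eq2)
  moreover have "coeff (reduced_poly (Suc n)) (Suc n) = 1"
    unfolding coeff_reduced_poly_Suc using Suc by simp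
  moreover have "\<forall>k>Suc n. coeff (derangement_poly_B (Suc n)) k = 0"
    using Suc by (simp add: derangement_poly_B_Suc coeff_pCons split: nat.split)
  ultimately show ?case by blast
qed

lemma degree_reduced_poly: "degree (reduced_poly n) = n"
  using coeff_reduced_poly[of n] by (intro antisym degree_le le_degree) auto

lemma lead_coeff_reduced_poly: "lead_coeff (reduced_poly n) = 1"
  using coeff_reduced_poly[of n] by (simp add: degree_reduced_poly)

text \<open>At \<open>0\<close> the recursion leaves twice the previous value plus a nonnegative
  term. This is the sign at the right end required by \<open>interlacing_step\<close>.\<close>

lemma poly_reduced_poly_0: "poly (reduced_poly n) 0 > 0"
proof (induction n)
  case (Suc n)
  have "poly (derangement_poly_B n) 0 \<ge> 0"
    by (cases n) (simp_all add: derangement_poly_B_0 derangement_poly_B_Suc)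
  then show ?case using Suc by (simp add: add_pos_nonneg)
qed simp

text \<open>Two consecutive polynomials are carried through the induction because the recursion
  links three of them.\<close>

lemma reduced_poly_strictly_interlacing:
  "\<exists>s r. reduced_poly n = (\<Prod>i<n. [:- s i, 1:]) \<and>
     reduced_poly (Suc n) = (\<Prod>i<Suc n. [:- r i, 1:]) \<and>
     strictly_interlacing n s r \<and> (\<forall>i\<le>n. r i < 0)"
proof (induction n)
  case 0
  have "reduced_poly (Suc 0) = [:- (- 4), 1:]"
    by (simp add: derangement_poly_B_0)
  then show ?case
    by (intro exI[of _ "\<lambda>_. - 4"]) (simp add: strictly_interlacing_def)
next
  case (Suc n)
  then obtain s r where *: "reduced_poly n = (\<Prod>i<n. [:- s i, 1:])"
    "reduced_poly (Suc n) = (\<Prod>i<Suc n. [:- r i, 1:])"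
    "strictly_interlacing n s r" "\<And>i. i \<le> n \<Longrightarrow> r i < 0" by blast
  have "\<exists>t. reduced_poly (Suc (Suc n)) = (\<Prod>i<Suc (Suc n). [:- t i, 1:]) \<and>
      strictly_interlacing (Suc n) r t \<and> (\<forall>i\<le>Suc n. t i < 0)"
  proof (rule interlacing_step[OF *])
    fix x :: real assume x: "poly (reduced_poly (Suc n)) x = 0" "x < 0"
    \<comment> \<open>At a root of \<open>e\<^sub>n\<^sub>+\<^sub>1\<close> only the derivative term
      and \<open>d\<^sub>n\<^sub>+\<^sub>1 = q e\<^sub>n\<close> survive; \<open>?a\<close> and
      \<open>?b\<close> are their coefficients negated, positive for \<open>x < 0\<close>.\<close>
    let ?a = "2 * (- x) * (1 - x)" and ?b = "(2 * real n + 4) * (- x)"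
    have "poly (reduced_poly (Suc (Suc n))) x =
        - (?a * poly (pderiv (reduced_poly (Suc n))) x + ?b * poly (reduced_poly n) x)"
      unfolding reduced_poly.simps(2)[of "Suc n"] derangement_poly_B_Suc
      using x(1) by (simp del: reduced_poly.simps add: algebra_simps)
    moreover have "?a > 0" "?b > 0" using x(2) by (auto intro: mult_neg_pos mult_pos_neg)
    ultimately show "\<exists>a b. a > 0 \<and> b > 0 \<and> poly (reduced_poly (Suc (Suc n))) x =
        - (a * poly (pderiv (reduced_poly (Suc n))) x + b * poly (reduced_poly n) x)" by blast
  qed (assumption | rule degree_reduced_poly lead_coeff_reduced_poly poly_reduced_poly_0)+
  then show ?case using *(2) by blast
qed

section \<open>Return to the derangement polynomials\<close>

lemma pCons_0_prod_roots:
  fixes r :: "nat \<Rightarrow> real"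
  shows "pCons 0 (\<Prod>i<n. [:- r i, 1:]) = (\<Prod>x\<leftarrow>map r [0..<n] @ [0]. [:- x, 1:])"
proof -
  have "(\<Prod>i<n. [:- r i, 1:]) = (\<Prod>x\<leftarrow>map r [0..<n]. [:- x, 1:])"
    by (induction n) (simp_all add: mult.commute)
  then show ?thesis by simp
qed

text \<open>Both root lists get a final \<open>0\<close>, larger than all other entries, so the only
  new interlacing inequalities are \<open>r n \<le> 0 \<le> 0\<close>.\<close>

lemma interlaces_pCons_0:
  assumes il: "strictly_interlacing n s r" and neg: "\<And>i. i \<le> n \<Longrightarrow> r i < 0"
  shows "interlaces (pCons 0 (\<Prod>i<n. [:- s i, 1:])) (pCons 0 (\<Prod>i<Suc n. [:- r i, 1:]))"
proof -
  let ?rs = "map r [0..<Suc n] @ [0]" and ?ss = "map s [0..<n] @ [0]"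
  have s_neg: "s i < 0" if "i < n" for i
    using strictly_interlacing_less_left[OF il, of i n] neg[of n] that by simp
  have r_mono: "r i \<le> r j" if "i \<le> j" "j \<le> n" for i j
    using strictly_interlacing_less[OF il, of i j] that by (cases "i = j") auto
  have s_mono: "s i \<le> s j" if "i \<le> j" "j < n" for i j
    using strictly_interlacing_less_left[OF il, of i j]
      strictly_interlacing_less_right[OF il, of j j] that by (cases "i = j") auto
  have "sorted ?rs"
    using neg by (auto simp: sorted_append sorted_iff_nth_mono nth_append r_mono less_imp_le simp del: upt_Suc)
  moreover have "sorted ?ss"
    using s_neg by (auto simp: sorted_append sorted_iff_nth_mono nth_append s_mono less_imp_le)
  moreover have "?rs ! i \<le> ?ss ! i \<and> ?ss ! i \<le> ?rs ! Suc i" if "i < length ?ss" for i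
  proof (cases "i < n")
    case True
    then show ?thesis using il by (auto simp: nth_append strictly_interlacing_def less_imp_le simp del: upt_Suc)
  next
    case False
    then have "i = n" using that by simp
    then show ?thesis using neg[of n] by (simp add: nth_append less_imp_le del: upt_Suc)
  qed
  ultimately show ?thesis unfolding interlaces_def pCons_0_prod_roots
    by (intro exI[of _ ?rs] exI[of _ ?ss] exI[of _ 1]) simp
qed

text \<open>The last conjunct sharpens the weak inequalities of \<open>interlaces\<close>: away from
  \<open>0\<close> the separation is strict.\<close>

theorem theorem4p5:
  fixes n :: nat
  assumes "n \<ge> 1"
  shows "degree (derangement_poly_B n) = n \<and>
    card {x :: real. poly (derangement_poly_B n) x = 0} = n \<and>
    (\<forall>x :: real. poly (derangement_poly_B n) x = 0 \<longrightarrow> x \<le> 0) \<and>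
    interlaces (derangement_poly_B (n - 1)) (derangement_poly_B n) \<and>
    (\<forall>x :: real. poly (derangement_poly_B (n - 1)) x = 0 \<and>
       poly (derangement_poly_B n) x = 0 \<longrightarrow> x = 0)"
proof -
  obtain k where n: "n = Suc k" using assms by (cases n) auto
  let ?d = derangement_poly_B
  obtain r where e: "reduced_poly k = (\<Prod>i<k. [:- r i, 1:])"
    and neg: "\<And>i. i < k \<Longrightarrow> r i < 0" and inj: "inj_on r {..<k}"
    and il: "interlaces (?d k) (?d (Suc k))"
    and common: "\<And>x. poly (?d k) x = 0 \<Longrightarrow> poly (?d (Suc k)) x = 0 \<Longrightarrow> x = 0"
  proof (cases k)
    \<comment> \<open>Since \<open>d\<^sub>0 = 1\<close> is not a multiple of \<open>q\<close>, the
      first pair is checked directly, with root lists \<open>[0]\<close> and \<open>[]\<close>. The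
      family \<open>r\<close> is a dummy, there being no index below \<open>0\<close>.\<close>
    case 0
    have "interlaces 1 (pCons 0 1)"
      unfolding interlaces_def
      by (intro exI[of _ "[0]"] exI[of _ "[]"] exI[of _ 1]) (simp add: one_pCons)
    then have "interlaces (?d k) (?d (Suc k))"
      using 0 by (simp add: derangement_poly_B_0 derangement_poly_B_Suc)
    then show ?thesis using 0 by (intro that[of "\<lambda>_. 0"]) (simp_all add: derangement_poly_B_0)
  next
    case (Suc m)
    obtain s r where *: "reduced_poly m = (\<Prod>i<m. [:- s i, 1:])"
      "reduced_poly (Suc m) = (\<Prod>i<Suc m. [:- r i, 1:])"
      "strictly_interlacing m s r" "\<And>i. i \<le> m \<Longrightarrow> r i < 0"
      using reduced_poly_strictly_interlacing[of m] by blast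
    show ?thesis
    proof (rule that[of r])
      show "reduced_poly k = (\<Prod>i<k. [:- r i, 1:])" using *(2) Suc by simp
      show "r i < 0" if "i < k" for i using *(4) that Suc by simp
      show "inj_on r {..<k}"
      proof (rule linorder_inj_onI)
        fix i j assume "i < j" "i \<in> {..<k}" "j \<in> {..<k}"
        then show "r i \<noteq> r j" using strictly_interlacing_less[OF *(3), of i j] Suc by auto
      qed auto
      show "interlaces (?d k) (?d (Suc k))"
        unfolding Suc derangement_poly_B_Suc *(1,2) by (rule interlaces_pCons_0[OF *(3,4)])
      fix x assume x: "poly (?d k) x = 0" "poly (?d (Suc k)) x = 0"
      show "x = 0"
      proof (rule ccontr)
        assume "x \<noteq> 0"
        \<comment> \<open>A nonzero common root survives cancelling \<open>q\<close> and would be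
          both some \<open>s j\<close> and some \<open>r i\<close>.\<close>
        then have "poly (reduced_poly m) x = 0" "poly (reduced_poly (Suc m)) x = 0"
          using x unfolding Suc derangement_poly_B_Suc by simp_all
        then obtain j i where ij: "j < m" "x = s j" "i < Suc m" "x = r i"
          unfolding *(1,2) poly_prod by auto
        then show False
          using strictly_interlacing_less_right[OF *(3), of i j]
            strictly_interlacing_less_left[OF *(3), of j i] by (cases "i \<le> j") auto
      qed
    qed
  qed
  have d: "?d n = pCons 0 (reduced_poly k)" by (simp add: n derangement_poly_B_Suc)
  have zeros: "{x. poly (?d n) x = 0} = insert 0 (r ` {..<k})"
    unfolding d e by (auto simp: poly_prod)
  have "0 \<notin> r ` {..<k}" using neg by force
  then have card: "card {x. poly (?d n) x = 0} = n"
    unfolding zeros using card_image[OF inj] n by simp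
  have nonpos: "x \<le> 0" if "poly (?d n) x = 0" for x
  proof -
    have "x \<in> insert 0 (r ` {..<k})" using that unfolding zeros[symmetric] by simp
    then show ?thesis using neg by (auto intro: less_imp_le)
  qed
  have "reduced_poly k \<noteq> 0" using lead_coeff_reduced_poly[of k] by auto
  then have "degree (?d n) = n" unfolding d by (simp add: n degree_reduced_poly)
  then show ?thesis using card nonpos il common n by simp
qed

end
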